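(* Let an $\mathrm{AVI}(C,q,M)$ be given, where $C=\{z\in\mathbb{R}^n:Az-b\in K,\ l\le z\le u\}$, $M\in\mathbb{R}^{n\times n}$, $q\in\mathbb{R}^n$. If the following conditions are satisfied at a point $\bar z\in C$, then a ray start can be performed at $\bar z$: (i) $M\bar z+q\in\operatorname{aff}(N_C(\bar z))$; (ii) $((\bar z+\operatorname{lin}C)+N_C(\bar z))\times\mathbb{R}_+$ is an $(n+1)$-cell all of whose interior points are regular; (iii) there exists a complementary basis at $\bar z$ such that $\operatorname{aff}(N_C(\bar z))$ is spanned by the columns of the basic variables in $(\lambda,w,v)$.
   Context: $\mathrm{AVI}(C,q,M)$: find $z\in C$ with $\langle Mz+q,y-z\rangle\ge0$ for all $y\in C$. Here $A\in\mathbb{R}^{m\times n}$ has nonzero rows, $b\in\mathbb{R}^m$, $l_j,u_j\in\mathbb{R}\cup\{\pm\infty\}$, and $K$ is a Cartesian product of $m$ copies of $\mathbb{R}_+$, $\{0\}$ or $\mathbb{R}_-$; $K^D$ is the dual cone $\{y:\langle y,k\rangle\ge0\ \forall k\in K\}$. $N_C(z)=\{y:\langle y,z'-z\rangle\le0\ \forall z'\in C\}$; $\operatorname{lin}C$ is the lineality space; $\pi_C$ is the Euclidean projection onto $C$. For a covering vector $r\in\mathbb{R}^n$, $G_C(x,t)=M\pi_C(x)+q+x-\pi_C(x)-tr$ for $(x,t)\in\mathbb{R}^n\times\mathbb{R}_+$. Cells: for each nonempty face $F$ of $C$, let $N_F$ be the constant value of $N_C$ on $\operatorname{ri}F$; the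 sets $(F+N_F)\times\mathbb{R}_+$ are the $(n+1)$-cells. A point in the interior of an $(n+1)$-cell $\sigma\times\mathbb{R}_+$ is regular if $\dim G_C(\sigma\times\mathbb{R}_+)=n$. Complementary basis at $\bar z$: consider the linear system $Mz+q-A^T\lambda-w+v=0$, $Az-b=s$ in the unknowns $(z,\lambda,w,v,s)$ with complementarity $K\ni s\perp\lambda\in K^D$, $0\le z-l\perp w\ge0$, $0\le u-z\perp v\ge0$ (components of $w$ resp. $v$ attached to infinite lower resp. upper bounds are absent). A complementary basis is a choice of $n+m$ variables (the basic variables) whose columns form an invertible matrix, containing exactly one of $s_i,\lambda_i$ for each $i$ and exactly one of $z_j,w_j,v_j$ for each $j$; nonbasic $\lambda,w,v,s$ are set to $0$, and a nonbasic $z_j$ is set to $l_j$ if $w_j$ is basic and to $u_j$ if $v_j$ is basic. It is a complementary basis at $\bar z$ if the resulting basic solution has $z=\bar z$ (the sign conditions on $\lambda,w,v$ need not hold). The column of $\lambda_i$, $w_j$, $v_j$ in (iii) means its column in the first block of equations: $-A_{i\bullet}^T$, $-e_j$, $e_j$ respectively. "A ray start can be performed at $\bar z$" means: there exist $r\in\operatorname{ri}(N_C(\bar z))$, $t^0\ge0$ and an affine map $t\mapsto x(t)$ such that for all $t\ge t^0$ one has $\pi_C(x(t))=\bar z$ and $G_C(x(t),t)=0$, with $(x(t),t)$ in the cell $((\bar z+\operatorname{lin}C)+N_C(\bar z))\times\mathbb{R}_+$ (in its interior for $t>t^0$) and the points of the ray interior to that cell being regular. *)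

theory Defs
  imports "HOL-Analysis.Analysis"
begin

section \<open>The feasible set\<close>

definition sign_cone_product :: "(real ^ 'm) set \<Rightarrow> bool" where
  "sign_cone_product K \<longleftrightarrow>
     (\<exists>\<kappa> :: 'm \<Rightarrow> real set.
        (\<forall>i. \<kappa> i \<in> {{0..}, {0}, {..0}}) \<and> K = {y. \<forall>i. y $ i \<in> \<kappa> i})"

definition feasible_set ::
    "real ^ 'n ^ 'm \<Rightarrow> real ^ 'm \<Rightarrow> (real ^ 'm) set \<Rightarrow> ereal ^ 'n \<Rightarrow> ereal ^ 'n \<Rightarrow> (real ^ 'n) set" where
  "feasible_set A b K l u =
     {z. A *v z - b \<in> K \<and> (\<forall>j. l $ j \<le> ereal (z $ j) \<and> ereal (z $ j) \<le> u $ j)}"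

section \<open>Normal cones, the normal map and its cells\<close>

definition normal_cone :: "'a::real_inner set \<Rightarrow> 'a \<Rightarrow> 'a set" where
  "normal_cone C z = {y. \<forall>z'\<in>C. y \<bullet> (z' - z) \<le> 0}"

definition lineality_space :: "'a::real_vector set \<Rightarrow> 'a set" where
  "lineality_space C = {d. \<forall>z\<in>C. \<forall>t::real. z + t *\<^sub>R d \<in> C}"

definition normal_map ::
    "real ^ 'n ^ 'n \<Rightarrow> real ^ 'n \<Rightarrow> (real ^ 'n) set \<Rightarrow> real ^ 'n \<Rightarrow> (real ^ 'n) \<times> real \<Rightarrow> real ^ 'n" where
  "normal_map M q C r = (\<lambda>(x, t).
     M *v closest_point C x + q + x - closest_point C x - t *\<^sub>R r)"

text \<open>The value \<open>N_F\<close> that the normal cone of \<open>C\<close> takes at every point of the relative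
  interior of the nonempty face \<open>F\<close>.\<close>

definition face_normal_cone :: "'a::euclidean_space set \<Rightarrow> 'a set \<Rightarrow> 'a set" where
  "face_normal_cone C F = (THE N. normal_cone C ` rel_interior F = {N})"

definition top_cell :: "'a::euclidean_space set \<Rightarrow> ('a \<times> real) set \<Rightarrow> bool" where
  "top_cell C S \<longleftrightarrow>
     (\<exists>F. F face_of C \<and> F \<noteq> {} \<and> S = (F + face_normal_cone C F) \<times> {0..})"

definition regular_point ::
    "real ^ 'n ^ 'n \<Rightarrow> real ^ 'n \<Rightarrow> (real ^ 'n) set \<Rightarrow> real ^ 'n \<Rightarrow> (real ^ 'n) \<times> real \<Rightarrow> bool" where
  "regular_point M q C r p \<longleftrightarrow>
     (\<exists>S. top_cell C S \<and> p \<in> interior S \<and>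
          aff_dim (normal_map M q C r ` S) = int CARD('n))"

definition ray_cell :: "'a::euclidean_space set \<Rightarrow> 'a \<Rightarrow> ('a \<times> real) set" where
  "ray_cell C z = (((+) z ` lineality_space C) + normal_cone C z) \<times> {0..}"

text \<open>The affine map of the ray is \<open>t \<mapsto> a + t d\<close>.\<close>

definition ray_start_possible ::
    "real ^ 'n ^ 'n \<Rightarrow> real ^ 'n \<Rightarrow> (real ^ 'n) set \<Rightarrow> real ^ 'n \<Rightarrow> bool" where
  "ray_start_possible M q C z \<longleftrightarrow>
     top_cell C (ray_cell C z) \<and>
     (\<exists>r \<in> rel_interior (normal_cone C z). \<exists>t0 \<ge> 0. \<exists>x a d.
        x = (\<lambda>t::real. a + t *\<^sub>R d) \<and>
        (\<forall>t \<ge> t0.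
           closest_point C (x t) = z \<and>
           normal_map M q C r (x t, t) = 0 \<and>
           (x t, t) \<in> ray_cell C z \<and>
           (t > t0 \<longrightarrow> (x t, t) \<in> interior (ray_cell C z)) \<and>
           ((x t, t) \<in> interior (ray_cell C z) \<longrightarrow> regular_point M q C r (x t, t))))"

section \<open>Complementary bases\<close>

text \<open>The variables \<open>z\<^sub>j\<close>, \<open>\<lambda>\<^sub>i\<close>, \<open>w\<^sub>j\<close>, \<open>v\<^sub>j\<close>, \<open>s\<^sub>i\<close> of the linear system
  \<open>M z + q - A\<^sup>T \<lambda> - w + v = 0\<close>, \<open>A z - b = s\<close>, and the columns of its coefficient matrix
  (with \<open>s\<close> moved to the left-hand side), one function for each block of equations.\<close>

datatype ('n, 'm) avi_var = Z_var 'n | Lam_var 'm | W_var 'n | V_var 'n | S_var 'm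

primrec column1 ::
    "real ^ 'n ^ 'n \<Rightarrow> real ^ 'n ^ 'm \<Rightarrow> ('n, 'm) avi_var \<Rightarrow> real ^ 'n" where
  "column1 M A (Z_var j) = column j M"
| "column1 M A (Lam_var i) = - row i A"
| "column1 M A (W_var j) = - axis j 1"
| "column1 M A (V_var j) = axis j 1"
| "column1 M A (S_var i) = 0"

primrec column2 :: "real ^ 'n ^ 'm \<Rightarrow> ('n, 'm) avi_var \<Rightarrow> real ^ 'm" where
  "column2 A (Z_var j) = column j A"
| "column2 A (Lam_var i) = 0"
| "column2 A (W_var j) = 0"
| "column2 A (V_var j) = 0"
| "column2 A (S_var i) = - axis i 1"

definition system_column ::
    "real ^ 'n ^ 'n \<Rightarrow> real ^ 'n ^ 'm \<Rightarrow> ('n, 'm) avi_var \<Rightarrow> real ^ ('n + 'm)" where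
  "system_column M A x = (\<chi> k. case k of Inl j \<Rightarrow> column1 M A x $ j | Inr i \<Rightarrow> column2 A x $ i)"

text \<open>A basis is given by its set \<open>B\<close> of basic variables; \<open>\<beta>\<close> lists the \<open>n + m\<close> of them in some
  order. The finiteness conditions express that \<open>w\<^sub>j\<close> and \<open>v\<^sub>j\<close> are absent when the bound they
  belong to is infinite.\<close>

definition complementary_basis ::
    "real ^ 'n ^ 'n \<Rightarrow> real ^ 'n ^ 'm \<Rightarrow> ereal ^ 'n \<Rightarrow> ereal ^ 'n \<Rightarrow> ('n, 'm) avi_var set \<Rightarrow> bool" where
  "complementary_basis M A l u B \<longleftrightarrow>
     (\<forall>j. W_var j \<in> B \<longrightarrow> \<bar>l $ j\<bar> \<noteq> \<infinity>) \<and>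
     (\<forall>j. V_var j \<in> B \<longrightarrow> \<bar>u $ j\<bar> \<noteq> \<infinity>) \<and>
     (\<forall>i. \<exists>!x. x \<in> B \<and> x \<in> {S_var i, Lam_var i}) \<and>
     (\<forall>j. \<exists>!x. x \<in> B \<and> x \<in> {Z_var j, W_var j, V_var j}) \<and>
     (\<exists>\<beta> :: 'n + 'm \<Rightarrow> ('n, 'm) avi_var.
        bij_betw \<beta> UNIV B \<and>
        invertible ((\<chi> k c. system_column M A (\<beta> c) $ k) :: real ^ ('n + 'm) ^ ('n + 'm)))"

definition basic_solution ::
    "real ^ 'n ^ 'n \<Rightarrow> real ^ 'n \<Rightarrow> real ^ 'n ^ 'm \<Rightarrow> real ^ 'm \<Rightarrow> ereal ^ 'n \<Rightarrow> ereal ^ 'n \<Rightarrow>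
     ('n, 'm) avi_var set \<Rightarrow>
     real ^ 'n \<Rightarrow> real ^ 'm \<Rightarrow> real ^ 'n \<Rightarrow> real ^ 'n \<Rightarrow> real ^ 'm \<Rightarrow> bool" where
  "basic_solution M q A b l u B z lam w v s \<longleftrightarrow>
     M *v z + q - transpose A *v lam - w + v = 0 \<and> A *v z - b = s \<and>
     (\<forall>i. Lam_var i \<notin> B \<longrightarrow> lam $ i = 0) \<and>
     (\<forall>j. W_var j \<notin> B \<longrightarrow> w $ j = 0) \<and>
     (\<forall>j. V_var j \<notin> B \<longrightarrow> v $ j = 0) \<and>
     (\<forall>i. S_var i \<notin> B \<longrightarrow> s $ i = 0) \<and>
     (\<forall>j. Z_var j \<notin> B \<and> W_var j \<in> B \<longrightarrow> ereal (z $ j) = l $ j) \<and>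
     (\<forall>j. Z_var j \<notin> B \<and> V_var j \<in> B \<longrightarrow> ereal (z $ j) = u $ j)"

definition complementary_basis_at ::
    "real ^ 'n ^ 'n \<Rightarrow> real ^ 'n \<Rightarrow> real ^ 'n ^ 'm \<Rightarrow> real ^ 'm \<Rightarrow> ereal ^ 'n \<Rightarrow> ereal ^ 'n \<Rightarrow>
     ('n, 'm) avi_var set \<Rightarrow> real ^ 'n \<Rightarrow> bool" where
  "complementary_basis_at M q A b l u B z \<longleftrightarrow>
     complementary_basis M A l u B \<and> (\<exists>lam w v s. basic_solution M q A b l u B z lam w v s)"

end

theory Submission
  imports Defs
begin

text \<open>
  Write \<open>L\<close> for the lineality space and \<open>N\<close> for the normal cone at \<open>z\<close>. For any \<open>r\<close> in the
  relative interior of \<open>N\<close> the ray is \<open>x(t) = z - (M z + q) + t r\<close>: by (i), \<open>x(t) - z\<close> lies in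
  the relative interior of the cone \<open>N\<close> for large \<open>t\<close>, so \<open>x(t)\<close> projects to \<open>z\<close> and the normal
  map vanishes there. By (ii) \<open>z + L\<close> is a face of the polyhedron \<open>C\<close>, hence \<open>L\<close> is the
  orthogonal complement of \<open>N\<close>; so \<open>L + N\<close> is full-dimensional, and the ray lies in the interior of
  the cell. Regularity for this \<open>r\<close> means that \<open>M L\<close> and \<open>N\<close> together span the whole space. This
  is read off the complementary basis: a vector \<open>d\<close> that vanishes at the nonbasic positions of
  \<open>(z, s)\<close> is orthogonal to \<open>N\<close> by (iii), hence in \<open>L\<close>.
\<close>

section \<open>Normal cones and lineality spaces\<close>

lemma zero_in_normal_cone: "0 \<in> normal_cone C z"
  by (simp add: normal_cone_def)

lemma convex_normal_cone: "convex (normal_cone C z)"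
  unfolding convex_def normal_cone_def
  by (auto simp: inner_add_left intro!: add_nonpos_nonpos mult_nonneg_nonpos)

lemma cone_normal_cone: "cone (normal_cone C z)"
  unfolding cone_def normal_cone_def by (auto intro: mult_nonneg_nonpos)

lemma subspace_lineality_space: "subspace (lineality_space C)"
proof (rule subspaceI)
  show "0 \<in> lineality_space C"
    by (simp add: lineality_space_def)
next
  fix d e
  assume de: "d \<in> lineality_space C" "e \<in> lineality_space C"
  show "d + e \<in> lineality_space C"
    unfolding lineality_space_def
  proof (intro CollectI ballI allI)
    fix x and t :: real
    assume "x \<in> C"
    then have "(x + t *\<^sub>R d) + t *\<^sub>R e \<in> C"
      using de unfolding lineality_space_def by blast
    then show "x + t *\<^sub>R (d + e) \<in> C"
      by (simp add: algebra_simps)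
  qed
next
  fix c :: real and d
  assume "d \<in> lineality_space C"
  then show "c *\<^sub>R d \<in> lineality_space C"
    by (simp add: lineality_space_def)
qed

lemma lineality_spaceD:
  assumes "d \<in> lineality_space C" "z \<in> C"
  shows "z + d \<in> C" "z - d \<in> C"
proof -
  have *: "z + t *\<^sub>R d \<in> C" for t
    using assms by (simp add: lineality_space_def)
  from *[of 1] show "z + d \<in> C"
    by simp
  from *[of "- 1"] show "z - d \<in> C"
    by simp
qed

lemma normal_cone_inner_lineality:
  assumes "z \<in> C" "d \<in> lineality_space C" "y \<in> normal_cone C z"
  shows "y \<bullet> d = 0"
proof -
  have "z + d \<in> C" "z + (- d) \<in> C"
    using assms by (simp_all add: lineality_spaceD)
  then have "y \<bullet> (z + d - z) \<le> 0" "y \<bullet> (z + (- d) - z) \<le> 0"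
    using assms(3) unfolding normal_cone_def by blast+
  then show ?thesis
    by simp
qed

lemma normal_cone_translate_lineality:
  assumes "z \<in> C" "d \<in> lineality_space C" "y \<in> normal_cone C z"
  shows "y \<in> normal_cone C (z + d)"
proof -
  have "y \<bullet> (z' - (z + d)) = y \<bullet> (z' - z)" for z'
    using normal_cone_inner_lineality[OF assms] by (simp add: inner_simps)
  with assms(3) show ?thesis
    by (simp add: normal_cone_def)
qed

text \<open>Expanding \<open>norm (y - (z' - z))\<close> squared, the cross term is nonnegative for
  a normal vector \<open>y\<close>, so no \<open>z'\<close> in \<open>C\<close> is closer to
  \<open>z + y\<close> than \<open>z\<close> is.\<close>

lemma closest_point_add_normal:
  fixes C :: "'a::euclidean_space set"
  assumes "convex C" "closed C" "z \<in> C" "y \<in> normal_cone C z"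
  shows "closest_point C (z + y) = z"
proof -
  have "dist (z + y) z \<le> dist (z + y) z'" if "z' \<in> C" for z'
  proof -
    have "y \<bullet> (z' - z) \<le> 0"
      using assms(4) that by (simp add: normal_cone_def)
    moreover have "(norm (y - (z' - z)))\<^sup>2 = (norm y)\<^sup>2 - 2 * (y \<bullet> (z' - z)) + (norm (z' - z))\<^sup>2"
      by (simp add: power2_norm_eq_inner inner_simps inner_commute)
    ultimately have "(norm y)\<^sup>2 \<le> (norm (y - (z' - z)))\<^sup>2"
      using zero_le_power2[of "norm (z' - z)"] by linarith
    then have "norm y \<le> norm (y - (z' - z))"
      by (rule power2_le_imp_le) simp
    then show ?thesis
      by (simp add: dist_norm algebra_simps)
  qed
  then show ?thesis
    using closest_point_unique[OF assms(1-3), of "z + y"] by simp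
qed

lemma closest_point_normal_cone:
  fixes C :: "'a::euclidean_space set"
  assumes "convex C" "closed C" "C \<noteq> {}"
  shows "x - closest_point C x \<in> normal_cone C (closest_point C x)"
  using closest_point_dot[OF assms(1,2)] by (simp add: normal_cone_def)

text \<open>The segment from \<open>y\<close> to the relative interior point \<open>x\<close>
  extends beyond \<open>x\<close> inside \<open>F\<close>. A linear functional that is maximal over
  \<open>C\<close> at \<open>x\<close> is therefore constant along it, and so maximal at
  \<open>y\<close> too.\<close>

lemma normal_cone_rel_interior_face_le:
  fixes C :: "'a::euclidean_space set"
  assumes "F \<subseteq> C" "convex F" "x \<in> rel_interior F" "y \<in> F"
  shows "normal_cone C x \<subseteq> normal_cone C y"
proof
  fix n
  assume n: "n \<in> normal_cone C x"
  obtain e where e: "e > 1" "(1 - e) *\<^sub>R y + e *\<^sub>R x \<in> F"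
    using convex_rel_interior_if2[OF assms(2,3)] hull_inc[OF assms(4), of affine] by blast
  have "((1 - e) *\<^sub>R y + e *\<^sub>R x) \<in> C" "y \<in> C"
    using e(2) assms(1,4) by blast+
  then have "n \<bullet> (((1 - e) *\<^sub>R y + e *\<^sub>R x) - x) \<le> 0" "n \<bullet> (y - x) \<le> 0"
    using n unfolding normal_cone_def by simp_all
  moreover have "((1 - e) *\<^sub>R y + e *\<^sub>R x) - x = (1 - e) *\<^sub>R (y - x)"
    by (simp add: algebra_simps)
  ultimately have "(1 - e) * (n \<bullet> (y - x)) \<le> 0" "n \<bullet> (y - x) \<le> 0"
    by simp_all
  with e(1) have "n \<bullet> (y - x) = 0"
    by (auto simp: mult_le_0_iff)
  then have "n \<bullet> (z' - y) = n \<bullet> (z' - x)" for z'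
    by (simp add: inner_simps)
  with n show "n \<in> normal_cone C y"
    by (simp add: normal_cone_def)
qed

text \<open>The previous inclusion, used in both directions, makes the image a singleton, so the
  definite description in \<open>face_normal_cone\<close> denotes.\<close>

lemma face_normal_cone_eq:
  fixes C :: "'a::euclidean_space set"
  assumes "F face_of C" "x \<in> rel_interior F"
  shows "face_normal_cone C F = normal_cone C x"
proof -
  have "F \<subseteq> C" "convex F"
    using assms(1) face_of_imp_subset face_of_imp_convex by auto
  then have le: "normal_cone C y \<subseteq> normal_cone C y'"
    if "y \<in> rel_interior F" "y' \<in> rel_interior F" for y y'
    using normal_cone_rel_interior_face_le that rel_interior_subset by blast
  have "normal_cone C y = normal_cone C x" if "y \<in> rel_interior F" for y
    using le[OF that assms(2)] le[OF assms(2) that] by (rule subset_antisym)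
  then have "normal_cone C ` rel_interior F = (\<lambda>_. normal_cone C x) ` rel_interior F"
    by (rule image_cong[OF refl])
  also have "\<dots> = {normal_cone C x}"
    using assms(2) by (rule image_constant)
  finally show ?thesis
    unfolding face_normal_cone_def by simp
qed

text \<open>\<open>f\<close> is the midpoint of \<open>f + d\<close> and \<open>f - d\<close>, both
  in \<open>C\<close>, so the face must contain these endpoints.\<close>

lemma face_of_translate_lineality:
  assumes "F face_of C" "f \<in> F" "d \<in> lineality_space C"
  shows "f + d \<in> F"
proof (cases "d = 0")
  case False
  have "f \<in> C"
    using assms(1,2) face_of_imp_subset by blast
  then have "f + d \<in> C" "f + (- d) \<in> C"
    using assms(3) by (simp_all add: lineality_spaceD)
  moreover have "f = midpoint (f + d) (f + (- d))"
    by (simp add: midpoint_def scaleR_2[symmetric])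
  moreover have "f + d \<noteq> f + (- d)"
    using False by (simp add: eq_neg_iff_add_eq_0 scaleR_2[symmetric])
  ultimately show ?thesis
    using face_ofD[OF assms(1), of f "f + d" "f + (- d)"] assms(2)
      midpoint_in_open_segment[of "f + d" "f + (- d)"] by simp
qed (use assms in simp)

text \<open>A cell is given only as a set, so its face has to be recovered from it. Projection onto
  \<open>C\<close> does this: a point of \<open>F\<close> is its own projection, but seen in the
  other sum it projects into \<open>z + L\<close>.\<close>

lemma top_cell_ray_cell_imp_face:
  fixes C :: "'a::euclidean_space set"
  assumes "convex C" "closed C" "z \<in> C" "top_cell C (ray_cell C z)"
  shows "(+) z ` lineality_space C face_of C"
proof -
  let ?L = "lineality_space C"
  obtain F where F: "F face_of C" "F \<noteq> {}"
    and eq: "ray_cell C z = (F + face_normal_cone C F) \<times> {0..}"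
    using assms(4) unfolding top_cell_def by blast
  have sum_eq: "(+) z ` ?L + normal_cone C z = F + face_normal_cone C F"
    using arg_cong[OF eq, of "image fst"] unfolding ray_cell_def by simp
  have "convex F"
    using F(1) face_of_imp_convex by blast
  with F(2) obtain x where "x \<in> rel_interior F"
    using rel_interior_eq_empty by blast
  then have zero: "0 \<in> face_normal_cone C F"
    using face_normal_cone_eq[OF F(1)] by (simp add: zero_in_normal_cone)
  have sub: "\<exists>d \<in> ?L. f = z + d" if "f \<in> F" for f
  proof -
    have "f + 0 \<in> F + face_normal_cone C F"
      using that zero by (rule set_plus_intro)
    then obtain d y where d: "d \<in> ?L" "y \<in> normal_cone C z" "f = z + d + y"
      unfolding sum_eq[symmetric] by (auto elim!: set_plus_elim)
    have "closest_point C f = z + d"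
      unfolding d(3)
      using closest_point_add_normal[OF assms(1,2)] lineality_spaceD[OF d(1) assms(3)]
        normal_cone_translate_lineality[OF assms(3) d(1,2)] by blast
    moreover have "closest_point C f = f"
      using that F(1) face_of_imp_subset closest_point_self by blast
    ultimately show ?thesis
      using d(1) by auto
  qed
  obtain f where "f \<in> F"
    using F(2) by blast
  with sub obtain d0 where d0: "d0 \<in> ?L" "z + d0 \<in> F"
    by blast
  \<comment> \<open>For the converse inclusion, one point \<open>z + d0\<close> of \<open>F\<close>
    suffices, as faces are invariant under translation by the lineality space.\<close>
  have "z + d \<in> F" if "d \<in> ?L" for d
  proof -
    have "(z + d0) + (d - d0) \<in> F"
      using face_of_translate_lineality[OF F(1) d0(2)] that d0(1)
        subspace_diff[OF subspace_lineality_space] by blast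
    then show ?thesis
      by simp
  qed
  with sub have "F = (+) z ` ?L"
    by blast
  with F(1) show ?thesis
    by simp
qed

section \<open>Polyhedra\<close>

text \<open>Halfspaces active at \<open>z\<close> are preserved by doubling the displacement from
  \<open>z\<close>; inactive ones have slack that absorbs a small displacement. Finiteness gives a
  common radius.\<close>

lemma polyhedron_locally_conic:
  fixes C :: "'a::euclidean_space set"
  assumes "polyhedron C" "z \<in> C"
  shows "\<exists>e>0. \<forall>x\<in>C. dist x z < e \<longrightarrow> z + 2 *\<^sub>R (x - z) \<in> C"
proof -
  obtain H where H: "finite H" "C = \<Inter>H"
    "\<And>h. h \<in> H \<Longrightarrow> \<exists>a b. h = {x. a \<bullet> x \<le> b}"
    using assms(1) unfolding polyhedron_def by metis
  have "\<exists>e>0. \<forall>x\<in>h. dist x z < e \<longrightarrow> z + 2 *\<^sub>R (x - z) \<in> h" if "h \<in> H" for h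
  proof -
    obtain a b where h: "h = {x. a \<bullet> x \<le> b}"
      using H(3)[OF \<open>h \<in> H\<close>] by blast
    have "a \<bullet> z \<le> b"
      using assms(2) H(2) \<open>h \<in> H\<close> h by auto
    show ?thesis
    proof (cases "a \<bullet> z = b")
      case True
      then have "z + 2 *\<^sub>R (x - z) \<in> h" if "x \<in> h" for x
        using that by (simp add: h inner_simps)
      then show ?thesis
        by (intro exI[of _ 1]) auto
    next
      case False
      \<comment> \<open>Adding 1 keeps the denominator positive when \<open>a = 0\<close>; the
        factor 2 in \<open>e\<close> pays for the doubling.\<close>
      define k where "k = norm a + 1"
      define e where "e = (b - a \<bullet> z) / (2 * k)"
      have pos: "k > 0"
        unfolding k_def by (intro add_nonneg_pos) auto
      have "e > 0"
        using False \<open>a \<bullet> z \<le> b\<close> pos unfolding e_def by (intro divide_pos_pos) auto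
      moreover have "z + 2 *\<^sub>R (x - z) \<in> h" if "dist x z < e" for x
      proof -
        have "a \<bullet> (x - z) \<le> norm a * norm (x - z)"
          by (rule norm_cauchy_schwarz)
        also have "\<dots> \<le> k * e"
          using that \<open>e > 0\<close> by (intro mult_mono) (auto simp: dist_norm k_def)
        also have "\<dots> = (b - a \<bullet> z) / 2"
          using pos unfolding e_def by simp
        finally show ?thesis
          by (simp add: h inner_simps)
      qed
      ultimately show ?thesis
        by blast
    qed
  qed
  then obtain e where e: "\<And>h. h \<in> H \<Longrightarrow> e h > 0"
    "\<And>h x. h \<in> H \<Longrightarrow> x \<in> h \<Longrightarrow> dist x z < e h \<Longrightarrow> z + 2 *\<^sub>R (x - z) \<in> h"
    by metis
  \<comment> \<open>The inserted 1 makes \<open>Min\<close> meaningful when \<open>H\<close> is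
    empty.\<close>
  define e0 where "e0 = Min (insert 1 (e ` H))"
  have "e0 > 0"
    unfolding e0_def using H(1) e(1) by (subst Min_gr_iff) auto
  moreover have "e0 \<le> e h" if "h \<in> H" for h
    unfolding e0_def using H(1) that by (intro Min_le) auto
  ultimately show ?thesis
    using e(2) H(2) by (intro exI[of _ e0]) fastforce
qed

text \<open>The projection \<open>p\<close> of \<open>z + t d\<close> is close to \<open>z\<close>, hence \<open>N(p) \<subseteq> N(z)\<close> by local
  conicity; so \<open>z + t d - p\<close> is orthogonal both to \<open>d\<close> and to \<open>p - z\<close>, that is, to itself.
  This replaces an appeal to Farkas' lemma.\<close>

lemma polyhedron_normal_cone_orthogonal_feasible:
  fixes C :: "'a::euclidean_space set"
  assumes "polyhedron C" "z \<in> C" "\<And>y. y \<in> normal_cone C z \<Longrightarrow> y \<bullet> d = 0"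
  shows "\<exists>e>0. \<forall>t. \<bar>t\<bar> < e \<longrightarrow> z + t *\<^sub>R d \<in> C"
proof -
  have C: "convex C" "closed C" "C \<noteq> {}"
    using assms(1,2) polyhedron_imp_convex polyhedron_imp_closed by blast+
  obtain e where e: "e > 0" "\<And>x. x \<in> C \<Longrightarrow> dist x z < e \<Longrightarrow> z + 2 *\<^sub>R (x - z) \<in> C"
    using polyhedron_locally_conic[OF assms(1,2)] by blast
  have "z + t *\<^sub>R d \<in> C" if t: "\<bar>t\<bar> < e / (norm d + 1)" for t
  proof -
    have pos: "norm d + 1 > 0"
      by (intro add_nonneg_pos) auto
    define x where "x = z + t *\<^sub>R d"
    define p where "p = closest_point C x"
    have pC: "p \<in> C"
      unfolding p_def using C closest_point_in_set by blast
    have np: "x - p \<in> normal_cone C p"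
      unfolding p_def using closest_point_normal_cone[OF C] .
    have "dist p z \<le> dist x z"
      using closest_point_lipschitz[OF C, of x z] closest_point_self[OF assms(2)]
      unfolding p_def by simp
    also have "\<dots> = \<bar>t\<bar> * norm d"
      by (simp add: x_def dist_norm)
    also have "\<dots> \<le> \<bar>t\<bar> * (norm d + 1)"
      by (intro mult_left_mono) auto
    also have "\<dots> < e"
      using t pos by (simp add: field_simps)
    finally have "z + 2 *\<^sub>R (p - z) \<in> C"
      using e(2) pC by blast
    \<comment> \<open>The doubled point and \<open>z\<close> lie on opposite sides of
      \<open>p\<close>, so the two normal cone inequalities combine to an equality.\<close>
    then have "(x - p) \<bullet> (z + 2 *\<^sub>R (p - z) - p) \<le> 0" "(x - p) \<bullet> (z - p) \<le> 0"
      using np assms(2) unfolding normal_cone_def by blast+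
    then have orth: "(x - p) \<bullet> (p - z) = 0"
      by (simp add: inner_simps)
    then have "(x - p) \<bullet> (z' - z) = (x - p) \<bullet> (z' - p)" for z'
      by (simp add: inner_simps)
    then have "x - p \<in> normal_cone C z"
      using np by (simp add: normal_cone_def)
    then have "(x - p) \<bullet> (t *\<^sub>R d) = 0"
      using assms(3) by simp
    moreover have "t *\<^sub>R d = (x - p) + (p - z)"
      by (simp add: x_def)
    ultimately have "(x - p) \<bullet> (x - p) = 0"
      using orth by (simp only: inner_add_right)
    then have "x = p"
      by simp
    with pC show ?thesis
      unfolding x_def by simp
  qed
  moreover have "e / (norm d + 1) > 0"
    using e(1) by (intro divide_pos_pos add_nonneg_pos) auto
  ultimately show ?thesis
    by blast
qed

text \<open>A short segment through \<open>z\<close> in direction \<open>d\<close> stays in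
  \<open>C\<close>, and \<open>z\<close> is interior to it. The face \<open>z + L\<close> thus
  contains its endpoints, which puts a multiple of \<open>d\<close> into \<open>L\<close>.\<close>

lemma lineality_space_orthogonal:
  fixes C :: "'a::euclidean_space set"
  assumes "polyhedron C" "z \<in> C" "(+) z ` lineality_space C face_of C"
    and "\<And>y. y \<in> normal_cone C z \<Longrightarrow> y \<bullet> d = 0"
  shows "d \<in> lineality_space C"
proof (cases "d = 0")
  case True
  then show ?thesis
    using subspace_0[OF subspace_lineality_space] by simp
next
  case False
  obtain e where e: "e > 0" "\<And>t. \<bar>t\<bar> < e \<Longrightarrow> z + t *\<^sub>R d \<in> C"
    using polyhedron_normal_cone_orthogonal_feasible[OF assms(1,2,4)] by blast
  define t where "t = e / 2"
  have t: "t > 0" "\<bar>t\<bar> < e" "\<bar>- t\<bar> < e"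
    using e(1) by (auto simp: t_def)
  let ?x = "z + t *\<^sub>R d" and ?y = "z + (- t) *\<^sub>R d"
  have "z = midpoint ?x ?y"
    by (simp add: midpoint_def scaleR_2[symmetric])
  moreover have "?x \<noteq> ?y"
    using False t(1) by (simp add: eq_neg_iff_add_eq_0 scaleR_2[symmetric])
  ultimately have "z \<in> open_segment ?x ?y"
    using midpoint_in_open_segment by metis
  moreover have "z \<in> (+) z ` lineality_space C"
    using subspace_0[OF subspace_lineality_space] by force
  ultimately have "?x \<in> (+) z ` lineality_space C"
    using assms(3) e(2)[OF t(2)] e(2)[OF t(3)] unfolding face_of_def by blast
  then have "t *\<^sub>R d \<in> lineality_space C"
    by auto
  then have "(1 / t) *\<^sub>R t *\<^sub>R d \<in> lineality_space C"
    by (rule subspace_scale[OF subspace_lineality_space])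
  then show ?thesis
    using t(1) by simp
qed

lemma span_lineality_normal_cone:
  fixes C :: "'a::euclidean_space set"
  assumes "polyhedron C" "z \<in> C" "(+) z ` lineality_space C face_of C"
  shows "\<exists>d\<in>lineality_space C. \<exists>n\<in>span (normal_cone C z). y = d + n"
proof -
  obtain n d where nd: "n \<in> span (normal_cone C z)"
    "\<And>w. w \<in> span (normal_cone C z) \<Longrightarrow> orthogonal d w" "y = n + d"
    using orthogonal_subspace_decomp_exists[of "normal_cone C z" y] by metis
  have "d \<in> lineality_space C"
    using nd(2) lineality_space_orthogonal[OF assms] span_base
    by (metis orthogonal_def inner_commute)
  with nd show ?thesis
    by (metis add.commute)
qed

lemma polyhedron_component_le: "polyhedron {z :: real ^ 'n. z $ j \<le> c}"
  using polyhedron_halfspace_le[of "axis j 1 :: real ^ 'n" c]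
  by (simp add: inner_axis' inner_real_def)

lemma polyhedron_component_ge: "polyhedron {z :: real ^ 'n. c \<le> z $ j}"
  using polyhedron_halfspace_ge[where a = "axis j 1 :: real ^ 'n" and b = c]
  by (simp add: inner_axis' inner_real_def)

lemma polyhedron_feasible_set:
  fixes A :: "real ^ 'n ^ 'm"
  assumes "sign_cone_product K"
  shows "polyhedron (feasible_set A b K l u)"
proof -
  obtain k where k: "\<And>i. k i \<in> {{0..}, {0}, {..0}}" and K: "K = {y. \<forall>i. y $ i \<in> k i}"
    using assms unfolding sign_cone_product_def by blast
  have "polyhedron {z. (A *v z - b) $ i \<in> k i}" for i
  proof -
    have eq: "(A *v z) $ i = A $ i \<bullet> z" for z
      by (rule matrix_vector_mul_component)
    from k[of i] consider "k i = {0..}" | "k i = {0}" | "k i = {..0}"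
      by blast
    then show ?thesis
      by cases (simp_all add: eq polyhedron_halfspace_le polyhedron_halfspace_ge
          polyhedron_hyperplane)
  qed
  \<comment> \<open>An infinite bound yields the whole space or the empty set, depending on its
    sign.\<close>
  moreover have "polyhedron {z :: real ^ 'n. l $ j \<le> ereal (z $ j)}" for j
    by (cases "l $ j") (auto simp: polyhedron_component_ge)
  moreover have "polyhedron {z :: real ^ 'n. ereal (z $ j) \<le> u $ j}" for j
    by (cases "u $ j") (auto simp: polyhedron_component_le)
  moreover have "feasible_set A b K l u =
      \<Inter> (range (\<lambda>i. {z. (A *v z - b) $ i \<in> k i})) \<inter>
      (\<Inter> (range (\<lambda>j. {z. l $ j \<le> ereal (z $ j)})) \<inter>
       \<Inter> (range (\<lambda>j. {z. ereal (z $ j) \<le> u $ j})))"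
    unfolding feasible_set_def K by auto
  ultimately show ?thesis
    by (auto intro!: polyhedron_Int polyhedron_Inter)
qed

section \<open>Complementary bases\<close>

text \<open>Separates the variables by their role in the basis system: \<open>z\<close> supplies
  \<open>d\<close>, the slacks vanish in the first block, and the multipliers vanish in the
  second.\<close>

lemma sum_avi_var:
  fixes h :: "('n::finite, 'm::finite) avi_var \<Rightarrow> 'a::comm_monoid_add"
  shows "sum h B =
    (\<Sum>j | Z_var j \<in> B. h (Z_var j)) + (\<Sum>i | S_var i \<in> B. h (S_var i)) +
    sum h (B \<inter> (range Lam_var \<union> range W_var \<union> range V_var))"
proof -
  let ?Z = "Z_var ` {j. Z_var j \<in> B}" and ?S = "S_var ` {i. S_var i \<in> B}"
  let ?R = "B \<inter> (range Lam_var \<union> range W_var \<union> range V_var)"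
  have "B = ?Z \<union> ?S \<union> ?R"
  proof (rule set_eqI)
    fix x
    show "x \<in> B \<longleftrightarrow> x \<in> ?Z \<union> ?S \<union> ?R"
      by (cases x) auto
  qed
  moreover have "sum h (?Z \<union> ?S \<union> ?R) = sum h ?Z + sum h ?S + sum h ?R"
    by (subst sum.union_disjoint, auto)+
  moreover have "sum h ?Z = (\<Sum>j | Z_var j \<in> B. h (Z_var j))"
    "sum h ?S = (\<Sum>i | S_var i \<in> B. h (S_var i))"
    by (subst sum.reindex; simp add: inj_on_def)+
  ultimately show ?thesis
    by metis
qed

text \<open>Solving the basis system with right-hand side \<open>(y, 0)\<close> gives a vector \<open>d\<close> whose entries
  and slacks vanish at the nonbasic positions, i.e. a vector orthogonal to the basic
  columns of \<open>\<lambda>, w, v\<close>.\<close>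

lemma complementary_basis_decomp:
  fixes M :: "real ^ 'n ^ 'n" and A :: "real ^ 'n ^ 'm"
  assumes "complementary_basis M A l u B"
  defines "X \<equiv> column1 M A ` (B \<inter> (range Lam_var \<union> range W_var \<union> range V_var))"
  shows "\<exists>d n. (\<forall>x\<in>X. x \<bullet> d = 0) \<and> n \<in> span X \<and> y = M *v d + n"
proof -
  obtain \<beta> :: "'n + 'm \<Rightarrow> ('n, 'm) avi_var" where \<beta>: "bij_betw \<beta> UNIV B"
    and inv: "invertible ((\<chi> k c. system_column M A (\<beta> c) $ k) :: real ^ ('n + 'm) ^ ('n + 'm))"
      (is "invertible ?P")
    using assms(1) unfolding complementary_basis_def by blast
  have exS: "\<exists>!x. x \<in> B \<and> x \<in> {S_var i, Lam_var i}" for i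
    using assms(1) unfolding complementary_basis_def by blast
  have exZ: "\<exists>!x. x \<in> B \<and> x \<in> {Z_var j, W_var j, V_var j}" for j
    using assms(1) unfolding complementary_basis_def by blast
  have nS: "S_var i \<notin> B" if "Lam_var i \<in> B" for i
    using exS[of i] that by auto
  have nZ: "Z_var j \<notin> B" if "W_var j \<in> B \<or> V_var j \<in> B" for j
    using exZ[of j] that by auto
  define y' :: "real ^ ('n + 'm)" where "y' = (\<chi> k. case k of Inl j \<Rightarrow> y $ j | Inr i \<Rightarrow> 0)"
  obtain c where c: "?P *v c = y'"
    using inv by (metis invertible_def matrix_vector_mul_assoc matrix_vector_mul_lid)
  define f where "f = (\<lambda>x. c $ inv_into UNIV \<beta> x)"
  have sys: "(\<Sum>x\<in>B. f x * system_column M A x $ k) = y' $ k" for k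
  proof -
    have "(\<Sum>x\<in>B. f x * system_column M A x $ k) =
        (\<Sum>i\<in>UNIV. f (\<beta> i) * system_column M A (\<beta> i) $ k)"
      by (rule sum.reindex_bij_betw[OF \<beta>, symmetric])
    also have "\<dots> = (?P *v c) $ k"
      using \<beta> by (simp add: f_def bij_betw_def matrix_vector_mult_def mult.commute)
    finally show ?thesis
      by (simp add: c)
  qed
  have eq1: "(\<Sum>x\<in>B. f x *\<^sub>R column1 M A x) = y"
    using sys[of "Inl _"] by (simp add: vec_eq_iff system_column_def y'_def)
  have eq2: "(\<Sum>x\<in>B. f x *\<^sub>R column2 A x) = 0"
    using sys[of "Inr _"] by (simp add: vec_eq_iff system_column_def y'_def)
  define d where "d = (\<chi> j. if Z_var j \<in> B then f (Z_var j) else 0)"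
  define n where "n = (\<Sum>x\<in>B \<inter> (range Lam_var \<union> range W_var \<union> range V_var). f x *\<^sub>R column1 M A x)"
  have mult_d: "D *v d = (\<Sum>j | Z_var j \<in> B. f (Z_var j) *\<^sub>R column j D)"
    for D :: "real ^ 'n ^ 'k"
  proof -
    have "D *v d = (\<Sum>j\<in>UNIV. d $ j *\<^sub>R column j D)"
      unfolding matrix_mult_sum scalar_mult_eq_scaleR ..
    also have "\<dots> = (\<Sum>j | Z_var j \<in> B. f (Z_var j) *\<^sub>R column j D)"
      by (intro sum.mono_neutral_cong_right) (auto simp: d_def)
    finally show ?thesis .
  qed
  have "y = M *v d + n"
    using eq1 unfolding sum_avi_var[of _ B] mult_d n_def by simp
  moreover have "n \<in> span X"
    unfolding n_def X_def by (intro span_sum span_scale span_base) blast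
  moreover have "x \<bullet> d = 0" if "x \<in> X" for x
  proof -
    have "(\<Sum>x\<in>B \<inter> (range Lam_var \<union> range W_var \<union> range V_var). f x *\<^sub>R column2 A x) = 0"
      by (intro sum.neutral) auto
    \<comment> \<open>Only basic slacks remain on the right, so \<open>A *v d\<close> vanishes in
      every row whose multiplier is basic.\<close>
    with eq2 have Ad: "A *v d = (\<Sum>i | S_var i \<in> B. f (S_var i) *\<^sub>R axis i 1)"
      unfolding sum_avi_var[of _ B] mult_d by (simp add: sum_negf)
    have lam: "row i A \<bullet> d = 0" if "Lam_var i \<in> B" for i
    proof -
      have "row i A \<bullet> d = (A *v d) $ i"
        by (simp add: matrix_vector_mul_component row_def vec_nth_inverse)
      also have "\<dots> = 0"
        unfolding Ad using nS[OF that] by (auto simp: axis_def intro!: sum.neutral)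
      finally show ?thesis .
    qed
    have "d $ j = 0" if "W_var j \<in> B \<or> V_var j \<in> B" for j
      using nZ[OF that] by (simp add: d_def)
    with lam that show ?thesis
      unfolding X_def by (auto simp: inner_axis inner_commute)
  qed
  ultimately show ?thesis
    by blast
qed

section \<open>The ray\<close>

text \<open>Within \<open>span N\<close>, the affine hull of \<open>N\<close>, the points
  \<open>r - c / t\<close> tend to \<open>r\<close> and so enter the relative interior; multiplying
  by \<open>t\<close> keeps them there.\<close>

lemma cone_rel_interior_eventually:
  fixes N :: "'a::euclidean_space set"
  assumes "cone N" "r \<in> rel_interior N" "c \<in> span N"
  shows "\<exists>t0>0. \<forall>t\<ge>t0. t *\<^sub>R r - c \<in> rel_interior N"
proof -
  have "r \<in> N"
    using assms(2) rel_interior_subset by blast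
  then have "0 \<in> N"
    using assms(1) cone_contains_0 by blast
  then have aff: "affine hull N = span N"
    by (simp add: affine_hull_span_0 hull_inc)
  obtain e where e: "e > 0" "\<And>x. x \<in> span N \<Longrightarrow> dist x r < e \<Longrightarrow> x \<in> rel_interior N"
    using openin_rel_interior[of N] assms(2) unfolding aff openin_euclidean_subtopology_iff by blast
  have "t *\<^sub>R r - c \<in> rel_interior N" if t: "t \<ge> (norm c + 1) / e" for t
  proof -
    have "(norm c + 1) / e > 0"
      using e(1) by (intro divide_pos_pos add_nonneg_pos) auto
    with t have "t > 0"
      by linarith
    have "norm c < t * e"
      using t e(1) by (simp add: field_simps)
    then have "dist (r - (1 / t) *\<^sub>R c) r < e"
      using \<open>t > 0\<close> by (simp add: dist_norm field_simps)
    moreover have "r - (1 / t) *\<^sub>R c \<in> span N"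
      using \<open>r \<in> N\<close> assms(3) by (intro span_diff span_scale) (auto intro: span_base)
    ultimately have *: "r - (1 / t) *\<^sub>R c \<in> rel_interior N"
      using e(2) by blast
    have tr: "t *\<^sub>R (r - (1 / t) *\<^sub>R c) = t *\<^sub>R r - c"
      using \<open>t > 0\<close> by (simp add: algebra_simps)
    have "t *\<^sub>R (r - (1 / t) *\<^sub>R c) \<in> {0} \<union> rel_interior N"
      using mem_cone[OF cone_rel_interior[OF assms(1)] UnI2[OF *], of t] \<open>t > 0\<close> by simp
    \<comment> \<open>If the scaled vector is 0, then so is the unscaled one, which is already known
      to be in the relative interior.\<close>
    then show ?thesis
      using * \<open>t > 0\<close> unfolding tr[symmetric] by auto
  qed
  moreover have "(norm c + 1) / e > 0"
    using e(1) by (intro divide_pos_pos add_nonneg_pos) auto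
  ultimately show ?thesis
    by blast
qed

lemma affine_hull_translate_set_plus:
  fixes S T :: "'a::euclidean_space set"
  assumes "0 \<in> S" "0 \<in> T" "\<And>y. \<exists>s\<in>span S. \<exists>t\<in>span T. y = s + t"
  shows "affine hull ((+) a ` (S + T)) = UNIV"
proof -
  have sub: "S \<subseteq> S + T" "T \<subseteq> S + T"
    using set_zero_plus2[OF assms(2), of S] set_zero_plus2[OF assms(1), of T]
    by (simp_all add: add.commute)
  have "y \<in> span (S + T)" for y
    using assms(3)[of y] span_mono[OF sub(1)] span_mono[OF sub(2)] by (auto intro: span_add)
  moreover have "0 \<in> S + T"
    using sub assms(1) by blast
  ultimately have "affine hull (S + T) = UNIV"
    by (auto simp: affine_hull_span_0 hull_inc)
  then show ?thesis
    unfolding affine_hull_translation using surj_plus by simp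
qed

theorem proposition3p1:
  fixes A :: "real ^ 'n ^ 'm" and b :: "real ^ 'm" and K :: "(real ^ 'm) set"
    and l u :: "ereal ^ 'n" and M :: "real ^ 'n ^ 'n" and q :: "real ^ 'n"
    and C :: "(real ^ 'n) set" and r :: "real ^ 'n" and z :: "real ^ 'n"
  assumes rows: "\<And>i. row i A \<noteq> 0"
    and K: "sign_cone_product K"
    and C: "C = feasible_set A b K l u"
    and z: "z \<in> C"
    and i: "M *v z + q \<in> affine hull (normal_cone C z)"
    and ii: "top_cell C (ray_cell C z)"
      "\<And>p. p \<in> interior (ray_cell C z) \<Longrightarrow> regular_point M q C r p"
    and iii: "\<exists>B. complementary_basis_at M q A b l u B z \<and>
      affine hull (normal_cone C z) =
        span (column1 M A ` (B \<inter> (range Lam_var \<union> range W_var \<union> range V_var)))"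
  shows "ray_start_possible M q C z"
proof -
  define L where "L = lineality_space C"
  define N where "N = normal_cone C z"
  have poly: "polyhedron C"
    unfolding C using K by (rule polyhedron_feasible_set)
  have cvx: "convex C" and cl: "closed C"
    using poly polyhedron_imp_convex polyhedron_imp_closed by blast+
  have L: "subspace L" and N: "convex N" "cone N" "0 \<in> N"
    unfolding L_def N_def
    by (simp_all add: subspace_lineality_space convex_normal_cone cone_normal_cone
        zero_in_normal_cone)
  have "0 \<in> L"
    using L by (rule subspace_0)
  have aff: "affine hull N = span N"
    using N(3) by (simp add: affine_hull_span_0 hull_inc)
  have face: "(+) z ` lineality_space C face_of C"
    using cvx cl z ii(1) by (rule top_cell_ray_cell_imp_face)
  obtain B where B: "complementary_basis M A l u B"
    and spanB: "span N = span (column1 M A ` (B \<inter> (range Lam_var \<union> range W_var \<union> range V_var)))"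
    using iii aff unfolding complementary_basis_at_def N_def by auto
  let ?X = "column1 M A ` (B \<inter> (range Lam_var \<union> range W_var \<union> range V_var))"
  \<comment> \<open>The \<open>d\<close> of the basis decomposition is orthogonal to the basic
    multiplier columns, hence to their span, which contains \<open>N\<close>; so it lies in
    \<open>L\<close>.\<close>
  have MLN: "\<exists>s\<in>span ((*v) M ` L). \<exists>n\<in>span N. y = s + n" for y
  proof -
    obtain d n where dn: "\<And>x. x \<in> ?X \<Longrightarrow> x \<bullet> d = 0" "n \<in> span ?X" "y = M *v d + n"
      using complementary_basis_decomp[OF B] by metis
    have "x \<bullet> d = 0" if "x \<in> N" for x
    proof -
      have "x \<in> span ?X"
        using that spanB span_base by metis
      moreover have "orthogonal d x'" if "x' \<in> ?X" for x'
        using dn(1)[OF that] by (simp add: orthogonal_def inner_commute)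
      ultimately have "orthogonal d x"
        by (rule orthogonal_to_span)
      then show ?thesis
        by (simp add: orthogonal_def inner_commute)
    qed
    then have "d \<in> L"
      unfolding L_def N_def using lineality_space_orthogonal[OF poly z face] by blast
    then have "M *v d \<in> span ((*v) M ` L)"
      by (intro span_base imageI)
    with dn(2,3) spanB show ?thesis
      by auto
  qed
  have LN: "\<exists>s\<in>span L. \<exists>n\<in>span N. y = s + n" for y
    using span_lineality_normal_cone[OF poly z face, of y] span_base
    unfolding L_def N_def by blast
  have cell: "ray_cell C z = ((+) z ` (L + N)) \<times> {0..}"
  proof -
    have "(+) z ` L + N = (+) z ` (L + N)"
      by (auto simp: set_plus_def image_iff add.assoc)
    then show ?thesis
      by (simp add: ray_cell_def L_def N_def)
  qed
  have proj: "closest_point C (z + d + n) = z + d" if "d \<in> L" "n \<in> N" for d n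
    using that closest_point_add_normal[OF cvx cl] lineality_spaceD
      normal_cone_translate_lineality z unfolding L_def N_def by blast
  obtain r' where r': "r' \<in> rel_interior N"
    using N(1,3) rel_interior_eq_empty by blast
  define c where "c = M *v z + q"
  have "c \<in> span N"
    using i aff unfolding c_def N_def by simp
  then obtain t0 where t0: "t0 > 0" "\<And>t. t \<ge> t0 \<Longrightarrow> t *\<^sub>R r' - c \<in> rel_interior N"
    using cone_rel_interior_eventually[OF N(2) r'] by blast
  \<comment> \<open>The slice \<open>t = 0\<close> suffices: there the normal map sends
    \<open>z + d + n\<close> to \<open>c + M *v d + n\<close>, and \<open>MLN\<close> makes these
    values affinely span the space.\<close>
  have full: "aff_dim (normal_map M q C r' ` ray_cell C z) = int CARD('n)"
  proof -
    have "(+) c ` ((*v) M ` L + N) \<subseteq> normal_map M q C r' ` ray_cell C z"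
    proof clarify
      fix x
      assume "x \<in> (*v) M ` L + N"
      then obtain d n where dn: "d \<in> L" "n \<in> N" "x = M *v d + n"
        by (auto elim!: set_plus_elim)
      have "normal_map M q C r' (z + d + n, 0) = c + x"
        using proj[OF dn(1,2)]
        by (simp add: normal_map_def c_def dn(3) matrix_vector_right_distrib)
      moreover have "(z + d + n, 0) \<in> ray_cell C z"
        unfolding cell using dn(1,2) by (auto simp: add.assoc set_plus_intro)
      ultimately show "c + x \<in> normal_map M q C r' ` ray_cell C z"
        by (metis image_eqI)
    qed
    moreover have "affine hull ((+) c ` ((*v) M ` L + N)) = UNIV"
    proof (rule affine_hull_translate_set_plus[OF _ N(3) MLN])
      show "0 \<in> (*v) M ` L"
        using \<open>0 \<in> L\<close> by force
    qed
    ultimately have "affine hull (normal_map M q C r' ` ray_cell C z) = UNIV"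
      using hull_mono by (metis top.extremum_uniqueI)
    then have "aff_dim (normal_map M q C r' ` ray_cell C z) = aff_dim (UNIV :: (real ^ 'n) set)"
      using aff_dim_affine_hull by metis
    then show ?thesis
      by simp
  qed
  \<comment> \<open>\<open>L + N\<close> has full affine hull, so its interior is its relative
    interior, which is \<open>L + rel_interior N\<close>.\<close>
  have inter: "z + n \<in> interior ((+) z ` (L + N))" if "n \<in> rel_interior N" for n
  proof -
    have "affine hull ((+) 0 ` (L + N)) = UNIV"
      using \<open>0 \<in> L\<close> N(3) LN by (rule affine_hull_translate_set_plus)
    then have "rel_interior (L + N) = interior (L + N)"
      by (intro rel_interior_interior) simp
    moreover have "rel_interior (L + N) = L + rel_interior N"
      using rel_interior_sum[of L N] L N(1)
      by (simp add: subspace_imp_convex subspace_imp_affine rel_interior_affine)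
    moreover have "0 + n \<in> L + rel_interior N"
      using \<open>0 \<in> L\<close> that by (rule set_plus_intro)
    ultimately have "n \<in> interior (L + N)"
      by simp
    then show ?thesis
      by (simp add: interior_translation)
  qed
  \<comment> \<open>This is the solution of \<open>normal_map M q C r' (x, t) = 0\<close> when the
    projection of \<open>x\<close> is assumed to be \<open>z\<close>.\<close>
  define x where "x = (\<lambda>t::real. (z - c) + t *\<^sub>R r')"
  have x_eq: "x t = z + (t *\<^sub>R r' - c)" for t
    by (simp add: x_def)
  have ray: "closest_point C (x t) = z \<and> normal_map M q C r' (x t, t) = 0 \<and>
      (x t, t) \<in> ray_cell C z \<and> (t > t0 \<longrightarrow> (x t, t) \<in> interior (ray_cell C z)) \<and>
      ((x t, t) \<in> interior (ray_cell C z) \<longrightarrow> regular_point M q C r' (x t, t))"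
    if t: "t \<ge> t0" for t
  proof (intro conjI impI)
    have n: "t *\<^sub>R r' - c \<in> rel_interior N"
      using t0(2) t by blast
    show cp: "closest_point C (x t) = z"
      using proj[OF \<open>0 \<in> L\<close>] n rel_interior_subset unfolding x_eq by fastforce
    show "normal_map M q C r' (x t, t) = 0"
      unfolding normal_map_def using cp by (simp add: x_def c_def)
    \<comment> \<open>Since \<open>t0 > 0\<close>, the second coordinate is interior to the
      half-line already at \<open>t = t0\<close>.\<close>
    have int: "(x t, t) \<in> interior (ray_cell C z)"
      unfolding cell interior_Times using inter[OF n] t t0(1) by (simp add: x_eq)
    then show "(x t, t) \<in> ray_cell C z" "(x t, t) \<in> interior (ray_cell C z)"
      using interior_subset by blast+
    show "regular_point M q C r' (x t, t)"
      unfolding regular_point_def using ii(1) int full by blast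
  qed
  show ?thesis
    unfolding ray_start_possible_def
  proof (intro conjI bexI exI)
    show "r' \<in> rel_interior (normal_cone C z)"
      using r' unfolding N_def .
    show "0 \<le> t0"
      using t0(1) by simp
    show "x = (\<lambda>t. (z - c) + t *\<^sub>R r')"
      by (fact x_def)
    show "\<forall>t\<ge>t0. closest_point C (x t) = z \<and> normal_map M q C r' (x t, t) = 0 \<and>
      (x t, t) \<in> ray_cell C z \<and> (t > t0 \<longrightarrow> (x t, t) \<in> interior (ray_cell C z)) \<and>
      ((x t, t) \<in> interior (ray_cell C z) \<longrightarrow> regular_point M q C r' (x t, t))"
      using ray by blast
  qed (fact ii(1))
qed

end
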